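(* Let $(\mathfrak{S},\mathfrak{C})$ be an SZLG-system, i.e. $\mathfrak{S}=\{(V_i,W_{i\oplus_3 1}):i\in\{1,2,3\}\}$ and $\mathfrak{C}=\{\{V_i,W_i\}:i\in\{1,2,3\}\}$. Then $$\Delta_0(\mathfrak{C})=\frac12\sum_{i=1}^3|\langle V_i\rangle-\langle W_i\rangle|,\qquad \Delta_{\min}(\mathfrak{S},\mathfrak{C})=\frac12\max\Big(2\Delta_0(\mathfrak{C}),\ \mathsf{s}_{odd}\big(\langle V_iW_{i\oplus_3 1}\rangle:i\in\{1,2,3\}\big)-1\Big).$$ Consequently $$\mathsf{CNTX}(\mathfrak{S},\mathfrak{C})=\frac12\max\Big(0,\ \mathsf{s}_{odd}\big(\langle V_iW_{i\oplus_3 1}\rangle:i\in\{1,2,3\}\big)-1-\sum_{i=1}^3|\langle V_i\rangle-\langle W_i\rangle|\Big),$$ and the system has a noncontextual description if and only if $$\mathsf{s}_{odd}\big(\langle V_iW_{i\oplus_3 1}\rangle:i\in\{1,2,3\}\big)\le 1+\sum_{i=1}^3|\langle V_i\rangle-\langle W_i\rangle|.$$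
   Context: $\oplus_3$ denotes cyclic addition on $\{1,2,3\}$ ($3\oplus_3 1=1$). All $V_i,W_i$ are $\pm1$-valued random variables. Each pair $(V_i,W_{i\oplus_3 1})$ is jointly distributed, but variables in different pairs are stochastically unrelated (have no given joint distribution); in particular $V_i$ and $W_i$ are never jointly distributed. $\langle\cdot\rangle$ denotes expectation; $\langle V_iW_{i\oplus_3 1}\rangle$ is computed from the given joint distribution of the pair. A coupling of random variables $A,B$ is a jointly distributed pair $(A^*,B^* )$ with $A^*\sim A$, $B^*\sim B$; it is maximal if $\Pr[A^*=B^*]$ is the largest possible over all couplings. A coupling $S$ of $\mathfrak{S}$ is a jointly distributed 6-tuple $(V_1^*,V_2^*,V_3^*,W_1^*,W_2^*,W_3^* )$ with $(V_i^*,W_{i\oplus_3 1}^* )$ distributed as $(V_i,W_{i\oplus_3 1})$ for each $i$. The system has a (maximally) noncontextual description if some coupling $S$ has each $(V_i^*,W_i^* )$ a maximal coupling of $V_i,W_i$. $\Delta_0(\mathfrak{C})=\frac12\sum_i|\langle V_i\rangle-\langle W_i\rangle|$; $\Delta_{\min}(\mathfrak{S},\mathfrak{C})$ is the infimum over all couplings $S$ of $\sum_{i=1}^3\Pr[V_i^*\ne W_i^*]$; $\mathsf{CNTX}(\mathfrak{S},\mathfrak{C})=\Delta_{\min}(\mathfrak{S},\mathfrak{C})-\Delta_0(\mathfrak{C})$. For reals $a_1,\ldots,a_m$, $\mathsf{s}_{odd}(a_1,\ldots,a_m)$ is the maximum of $\sum_{i=1}^m(\pm a_i)$ over all sign choices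 with an odd number of minus signs. *)

theory Defs
  imports "HOL-Probability.Probability"
begin

definition cyc :: "nat \<Rightarrow> nat" where
  "cyc i = (if i = 3 then 1 else i + 1)"

definition cpred :: "nat \<Rightarrow> nat" where
  "cpred i = (if i = 1 then 3 else i - 1)"

text \<open>An SZLG system is given by the joint distributions P i of the pairs (V_i, W_(cyc i)),
  i = 1,2,3, each a distribution on pm1 values. Different pairs have no joint distribution.\<close>
definition pm1 :: "real set" where "pm1 = {-1, 1}"

definition SZLG :: "(nat \<Rightarrow> (real \<times> real) pmf) \<Rightarrow> bool" where
  "SZLG P \<longleftrightarrow> (\<forall>i\<in>{1,2,3::nat}. set_pmf (P i) \<subseteq> pm1 \<times> pm1)"

definition distV :: "(nat \<Rightarrow> (real \<times> real) pmf) \<Rightarrow> nat \<Rightarrow> real pmf" where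
  "distV P i = map_pmf fst (P i)"

definition distW :: "(nat \<Rightarrow> (real \<times> real) pmf) \<Rightarrow> nat \<Rightarrow> real pmf" where
  "distW P i = map_pmf snd (P (cpred i))"

definition EV :: "(nat \<Rightarrow> (real \<times> real) pmf) \<Rightarrow> nat \<Rightarrow> real" where
  "EV P i = measure_pmf.expectation (distV P i) (\<lambda>x. x)"

definition EW :: "(nat \<Rightarrow> (real \<times> real) pmf) \<Rightarrow> nat \<Rightarrow> real" where
  "EW P i = measure_pmf.expectation (distW P i) (\<lambda>x. x)"

definition EVW :: "(nat \<Rightarrow> (real \<times> real) pmf) \<Rightarrow> nat \<Rightarrow> real" where
  "EVW P i = measure_pmf.expectation (P i) (\<lambda>(x, y). x * y)"

definition coupling_of :: "'a pmf \<Rightarrow> 'a pmf \<Rightarrow> ('a \<times> 'a) pmf \<Rightarrow> bool" where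
  "coupling_of A B C \<longleftrightarrow> map_pmf fst C = A \<and> map_pmf snd C = B"

definition maximal_coupling :: "'a pmf \<Rightarrow> 'a pmf \<Rightarrow> ('a \<times> 'a) pmf \<Rightarrow> bool" where
  "maximal_coupling A B C \<longleftrightarrow> coupling_of A B C \<and>
     (\<forall>C'. coupling_of A B C' \<longrightarrow>
        measure_pmf.prob C' {(a, b). a = b} \<le> measure_pmf.prob C {(a, b). a = b})"

text \<open>A coupling of the system: a joint distribution of (V_1*,V_2*,V_3*,W_1*,W_2*,W_3*),
  represented as a pair of functions (v, w) (values outside {1,2,3} irrelevant),
  such that (V_i*, W_(cyc i)*) is distributed as P i.\<close>
definition sys_coupling ::
  "(nat \<Rightarrow> (real \<times> real) pmf) \<Rightarrow> ((nat \<Rightarrow> real) \<times> (nat \<Rightarrow> real)) pmf \<Rightarrow> bool" where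
  "sys_coupling P S \<longleftrightarrow>
     (\<forall>i\<in>{1,2,3::nat}. map_pmf (\<lambda>(v, w). (v i, w (cyc i))) S = P i)"

definition Delta0 :: "(nat \<Rightarrow> (real \<times> real) pmf) \<Rightarrow> real" where
  "Delta0 P = (1/2) * (\<Sum>i\<in>{1,2,3::nat}. \<bar>EV P i - EW P i\<bar>)"

definition Deltamin :: "(nat \<Rightarrow> (real \<times> real) pmf) \<Rightarrow> real" where
  "Deltamin P = Inf {(\<Sum>i\<in>{1,2,3::nat}. measure_pmf.prob S {(v, w). v i \<noteq> w i}) | S.
                      sys_coupling P S}"

definition CNTX :: "(nat \<Rightarrow> (real \<times> real) pmf) \<Rightarrow> real" where
  "CNTX P = Deltamin P - Delta0 P"

definition noncontextual :: "(nat \<Rightarrow> (real \<times> real) pmf) \<Rightarrow> bool" where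
  "noncontextual P \<longleftrightarrow> (\<exists>S. sys_coupling P S \<and>
     (\<forall>i\<in>{1,2,3::nat}. maximal_coupling (distV P i) (distW P i)
                            (map_pmf (\<lambda>(v, w). (v i, w i)) S)))"

definition s_odd :: "real list \<Rightarrow> real" where
  "s_odd a = Max {sum_list (map2 (*) s a) | s.
      length s = length a \<and> set s \<subseteq> {-1, 1} \<and> odd (length (filter (\<lambda>x. x = -1) s))}"

end

theory Submission
  imports Defs
begin

text \<open>
  The six variables form a cycle V1, W2, V2, W3, V3, W1 in which the pairs (V1, W2), (V2, W3),
  (V3, W1) have given laws, while for the pairs (Vi, Wi) only the correlation \<open>c\<^sub>i\<close> may be chosen, and
  \<open>Pr[Vi \<noteq> Wi] = (1 - c\<^sub>i) / 2\<close>. The lower bound on the sum of these probabilities follows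
  from \<open>\<bar>\<langle>Vi\<rangle> - \<langle>Wi\<rangle>\<bar> \<le> 1 - c\<^sub>i\<close> and from the pointwise inequality that a signed sum of
  the six products along the cycle, with an odd number of minus signs, is at most 4.

  Conversely, choose the \<open>c\<^sub>i\<close> attaining the bound. They satisfy all odd-sign inequalities of the
  cycle, so correlations of the chords V1V2, V2V3, V3V1 can be found that make the
  triangle V1V2V3 and the three outer triangles compatible. Each triangle has a joint law, and the
  outer triangles are glued to the inner one along the chords; this is consistent because the law
  of a pair of \<open>\<plusminus>1\<close> variables is determined by its means and its correlation.
\<close>

section \<open>Moment inequalities\<close>

text \<open>For means \<open>a\<close>, \<open>b\<close> and correlation \<open>c\<close> these inequalities say that a pair of \<open>\<plusminus>1\<close> variables with
  these moments exists. Applied to three correlations, the same inequalities are the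
  compatibility condition for a triangle of such pairs.\<close>
definition admissible :: "real \<Rightarrow> real \<Rightarrow> real \<Rightarrow> bool" where
  "admissible a b c \<longleftrightarrow> \<bar>a + b\<bar> \<le> 1 + c \<and> \<bar>a - b\<bar> \<le> 1 - c"

lemma admissible_commute: "admissible a b c \<longleftrightarrow> admissible b a c"
  by (simp add: admissible_def add.commute abs_minus_commute)

lemma admissible_linear:
  assumes "admissible a b c"
  shows "a + b \<le> 1 + c" "- a - b \<le> 1 + c" "a - b \<le> 1 - c" "b - a \<le> 1 - c"
    "c \<le> 1" "- 1 \<le> c" "a \<le> 1" "- 1 \<le> a" "b \<le> 1" "- 1 \<le> b"
  using assms unfolding admissible_def by linarith+

text \<open>Triangle inequality applied to the constraints of the two edges that meet at
  \<open>b\<close>. These bounds allow a chord from \<open>a\<close> to \<open>c\<close> to respect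
  both its own means and the correlations \<open>p\<close>, \<open>q\<close>.\<close>

lemma admissible_compose:
  assumes "admissible a b p" "admissible b c q"
  shows "\<bar>p + q\<bar> \<le> 2 - \<bar>a - c\<bar>" "\<bar>p - q\<bar> \<le> 2 - \<bar>a + c\<bar>"
  using assms unfolding admissible_def by linarith+

lemma admissible_bounds:
  assumes "admissible a b c"
  shows "\<bar>a\<bar> \<le> 1" "\<bar>b\<bar> \<le> 1" "\<bar>c\<bar> \<le> 1"
  using assms unfolding admissible_def by linarith+

text \<open>The witnesses come from Fourier--Motzkin elimination of \<open>z\<close>, then \<open>y\<close>, then \<open>x\<close>.\<close>
lemma obtain_admissible_in_box:
  fixes lx ux ly uy lz uz :: real
  assumes "lx \<le> ux" "ly \<le> uy" "lz \<le> uz"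
    and "-1 \<le> lx" "ux \<le> 1" "-1 \<le> ly" "uy \<le> 1" "-1 \<le> lz" "uz \<le> 1"
    and "lx + ly - uz \<le> 1" "lx - uy + lz \<le> 1" "- ux + ly + lz \<le> 1" "- ux - uy - uz \<le> 1"
  obtains x y z where "lx \<le> x" "x \<le> ux" "ly \<le> y" "y \<le> uy" "lz \<le> z" "z \<le> uz" "admissible x y z"
proof -
  define x where "x = Max {lx, -1 - uz - uy, ly - 1 + lz}"
  define y where "y = Max {ly, -1 - uz - x, x - 1 + lz}"
  define z where "z = max lz (\<bar>x + y\<bar> - 1)"
  have x: "lx \<le> x" "-1 - uz - uy \<le> x" "ly - 1 + lz \<le> x" "x \<le> ux" "x \<le> 1 + uz - ly" "x \<le> uy + 1 - lz"
    using assms unfolding x_def by auto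
  have y: "ly \<le> y" "-1 - uz - x \<le> y" "x - 1 + lz \<le> y" "y \<le> uy" "y \<le> 1 + uz - x" "y \<le> x + 1 - lz"
    using assms x unfolding y_def by auto
  have "lz \<le> z" "z \<le> uz" "admissible x y z"
    using assms x y unfolding z_def admissible_def by (auto simp: max_def abs_if)
  then show thesis using that x y by blast
qed

text \<open>Of the eight sums hidden in the maxima, one is a hypothesis. In the others, the terms in
  \<open>a\<close>, \<open>b\<close>, \<open>c\<close> that replace some \<open>p\<close> are
  absorbed by the distances in the bounds on the remaining ones, or by
  \<open>|a|, |b|, |c| <= 1\<close>. The result supplies the corner conditions of the box
  lemma.\<close>

lemma three_max_le_4:
  fixes a b c :: real
  assumes "\<bar>a\<bar> \<le> 1" "\<bar>b\<bar> \<le> 1" "\<bar>c\<bar> \<le> 1"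
    and p: "p1 \<le> 2 - \<bar>a - b\<bar>" "p2 \<le> 2 - \<bar>b - c\<bar>" "p3 \<le> 2 - \<bar>c + a\<bar>" "p1 + p2 + p3 \<le> 4"
  shows "max p1 \<bar>a + b\<bar> + max p2 \<bar>b + c\<bar> + max p3 \<bar>c - a\<bar> \<le> 4"
proof -
  have "\<bar>a + b\<bar> \<le> \<bar>b - c\<bar> + \<bar>c + a\<bar>" "\<bar>b + c\<bar> \<le> \<bar>a - b\<bar> + \<bar>c + a\<bar>" "\<bar>c - a\<bar> \<le> \<bar>a - b\<bar> + \<bar>b - c\<bar>"
    "\<bar>a + b\<bar> + \<bar>b + c\<bar> \<le> 2 + \<bar>c + a\<bar>" "\<bar>a + b\<bar> + \<bar>c - a\<bar> \<le> 2 + \<bar>b - c\<bar>"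
    "\<bar>b + c\<bar> + \<bar>c - a\<bar> \<le> 2 + \<bar>a - b\<bar>" "\<bar>c - a\<bar> \<le> 2 - \<bar>c + a\<bar>"
    using assms(1-3) by linarith+
  \<comment> \<open>\<open>A\<close>, \<open>B\<close>, \<open>C\<close> stand for
    \<open>|a - b|\<close>, \<open>|b - c|\<close>, \<open>|c + a|\<close>; hiding the absolute
    values leaves a linear case split.\<close>
  moreover have "max x y + max z t + max u v \<le> 4"
    if "x \<le> 2 - A" "z \<le> 2 - B" "u \<le> 2 - C" "x + z + u \<le> 4" "y \<le> B + C" "t \<le> A + C" "v \<le> A + B"
      "y + t \<le> 2 + C" "y + v \<le> 2 + B" "t + v \<le> 2 + A" "v \<le> 2 - C" for x y z t u v A B C :: real
    using that by (simp add: max_def)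
  ultimately show ?thesis using p by blast
qed

text \<open>The six variables form the cycle V1, W2, V2, W3, V3, W1. The assumptions on \<open>e\<close> and \<open>c\<close> alone amount
  to the 32 odd-sign inequalities of this cycle; \<open>x\<close>, \<open>y\<close>, \<open>z\<close> are the correlations of the chords V1V2, V2V3, V3V1.\<close>
lemma chords_exist:
  fixes v1 v2 v3 w1 w2 w3 e1 e2 e3 c1 c2 c3 :: real
  assumes e: "admissible v1 w2 e1" "admissible v2 w3 e2" "admissible v3 w1 e3"
    and c: "admissible w1 v1 c1" "admissible w2 v2 c2" "admissible w3 v3 c3"
    and cyc: "\<bar>e1 + c2\<bar> + \<bar>e2 + c3\<bar> + \<bar>e3 - c1\<bar> \<le> 4"
      "\<bar>e3 + c1\<bar> + \<bar>e1 + c2\<bar> + \<bar>e2 - c3\<bar> \<le> 4"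
      "\<bar>e2 + c3\<bar> + \<bar>e3 + c1\<bar> + \<bar>e1 - c2\<bar> \<le> 4"
      "\<bar>e1 - c2\<bar> + \<bar>e2 - c3\<bar> + \<bar>e3 - c1\<bar> \<le> 4"
  obtains x y z where "admissible e1 c2 x" "admissible e2 c3 y" "admissible e3 c1 z"
    "admissible v1 v2 x" "admissible v2 v3 y" "admissible v3 v1 z" "admissible x y z"
proof -
  have b: "\<bar>v1\<bar> \<le> 1" "\<bar>v2\<bar> \<le> 1" "\<bar>v3\<bar> \<le> 1" "\<bar>e1\<bar> \<le> 1" "\<bar>e2\<bar> \<le> 1" "\<bar>e3\<bar> \<le> 1"
     "\<bar>c1\<bar> \<le> 1" "\<bar>c2\<bar> \<le> 1" "\<bar>c3\<bar> \<le> 1"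
    using e c by (auto dest: admissible_bounds)
  \<comment> \<open>A chord is constrained by the means \<open>a\<close>, \<open>b\<close> of its
    ends and by the correlations \<open>p\<close>, \<open>q\<close> of the outer triangle over it;
    together they leave a nonempty interval.\<close>
  have interval: "max (\<bar>p + q\<bar>) (\<bar>a + b\<bar>) - 1 \<le> 1 - max (\<bar>p - q\<bar>) (\<bar>a - b\<bar>)"
    if "\<bar>a\<bar> \<le> 1" "\<bar>b\<bar> \<le> 1" "\<bar>p\<bar> \<le> 1" "\<bar>q\<bar> \<le> 1"
      "\<bar>p + q\<bar> \<le> 2 - \<bar>a - b\<bar>" "\<bar>p - q\<bar> \<le> 2 - \<bar>a + b\<bar>" for a b p q :: real
  proof -
    have "\<bar>a + b\<bar> \<le> 2 - \<bar>a - b\<bar>" "\<bar>p + q\<bar> \<le> 2 - \<bar>p - q\<bar>" using that(1-4) by linarith+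
    with that(5,6) show ?thesis by (simp add: max_def)
  qed
  note t = admissible_compose[OF e(1) c(2)] admissible_compose[OF e(2) c(3)] admissible_compose[OF e(3) c(1)]
  have lower: "-1 \<le> max \<bar>p\<bar> q - 1" and upper: "1 - max \<bar>p\<bar> q \<le> 1" for p q :: real
    by auto
  \<comment> \<open>The corners with two lower ends and one upper end arise from one another by
    rotating the cycle.\<close>
  note four = three_max_le_4[OF b(1,2,3) t(1) t(3) t(6) cyc(1)]
    three_max_le_4[OF b(3,1,2) t(5) t(1) t(4) cyc(2)]
    three_max_le_4[OF b(2,3,1) t(3) t(5) t(2) cyc(3)]
  \<comment> \<open>The corner with three upper ends takes the same form once \<open>v2\<close> is
    replaced by \<open>- v2\<close>.\<close>
  have flip: "\<bar>- v2\<bar> = \<bar>v2\<bar>" "\<bar>v1 - - v2\<bar> = \<bar>v1 + v2\<bar>" "\<bar>- v2 - v3\<bar> = \<bar>v2 + v3\<bar>"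
    "\<bar>v1 + - v2\<bar> = \<bar>v1 - v2\<bar>" "\<bar>- v2 + v3\<bar> = \<bar>v2 - v3\<bar>"
    by linarith+
  from three_max_le_4[of v1 "- v2" v3, unfolded flip, OF b(1-3) t(2) t(4) t(6) cyc(4)]
  have four': "max (\<bar>e1 - c2\<bar>) (\<bar>v1 - v2\<bar>) + max (\<bar>e2 - c3\<bar>) (\<bar>v2 - v3\<bar>) + max (\<bar>e3 - c1\<bar>) (\<bar>v3 - v1\<bar>) \<le> 4" .
  have box: "max (\<bar>e1 + c2\<bar>) (\<bar>v1 + v2\<bar>) - 1 \<le> 1 - max (\<bar>e1 - c2\<bar>) (\<bar>v1 - v2\<bar>)"
    "max (\<bar>e2 + c3\<bar>) (\<bar>v2 + v3\<bar>) - 1 \<le> 1 - max (\<bar>e2 - c3\<bar>) (\<bar>v2 - v3\<bar>)"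
    "max (\<bar>e3 + c1\<bar>) (\<bar>v3 + v1\<bar>) - 1 \<le> 1 - max (\<bar>e3 - c1\<bar>) (\<bar>v3 - v1\<bar>)"
    by (intro interval b t)+
  have ineq: "p - 1 + (q - 1) - (1 - r) \<le> 1" "q - 1 - (1 - r) + (p - 1) \<le> 1" "- (1 - r) + (p - 1) + (q - 1) \<le> 1"
    "- (1 - p) - (1 - q) - (1 - r) \<le> 1" if "p + q + r \<le> 4" for p q r :: real
    using that by linarith+
  obtain x y z where xyz:
    "max (\<bar>e1 + c2\<bar>) (\<bar>v1 + v2\<bar>) - 1 \<le> x" "x \<le> 1 - max (\<bar>e1 - c2\<bar>) (\<bar>v1 - v2\<bar>)"
    "max (\<bar>e2 + c3\<bar>) (\<bar>v2 + v3\<bar>) - 1 \<le> y" "y \<le> 1 - max (\<bar>e2 - c3\<bar>) (\<bar>v2 - v3\<bar>)"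
    "max (\<bar>e3 + c1\<bar>) (\<bar>v3 + v1\<bar>) - 1 \<le> z" "z \<le> 1 - max (\<bar>e3 - c1\<bar>) (\<bar>v3 - v1\<bar>)"
    "admissible x y z"
    by (rule obtain_admissible_in_box[OF box lower upper lower upper lower upper
          ineq(1)[OF four(1)] ineq(2)[OF four(2)] ineq(3)[OF four(3)] ineq(4)[OF four']])
  have split: "admissible p q r" "admissible a b r"
    if "max (\<bar>p + q\<bar>) (\<bar>a + b\<bar>) - 1 \<le> r" "r \<le> 1 - max (\<bar>p - q\<bar>) (\<bar>a - b\<bar>)" for p q a b r
    using that unfolding admissible_def by (simp_all add: max_def split: if_splits)
  show thesis
    by (rule that[OF split(1)[OF xyz(1,2)] split(1)[OF xyz(3,4)] split(1)[OF xyz(5,6)]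
          split(2)[OF xyz(1,2)] split(2)[OF xyz(3,4)] split(2)[OF xyz(5,6)] xyz(7)])
qed

section \<open>Optimal correlations within the pairs (Vi, Wi)\<close>

lemma sum_of_interval_points:
  fixes l1 l2 l3 u1 u2 u3 s :: real
  assumes "l1 \<le> u1" "l2 \<le> u2" "l3 \<le> u3" "l1 + l2 + l3 \<le> s" "s \<le> u1 + u2 + u3"
  obtains c1 c2 c3 where "l1 \<le> c1" "c1 \<le> u1" "l2 \<le> c2" "c2 \<le> u2" "l3 \<le> c3" "c3 \<le> u3"
    "c1 + c2 + c3 = s"
proof -
  \<comment> \<open>Greedy choice: each point is as large as the lower ends of the later intervals
    permit.\<close>
  define c1 where "c1 = min u1 (s - l2 - l3)"
  define c2 where "c2 = min u2 (s - c1 - l3)"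
  show thesis
    using assms by (intro that[of c1 c2 "s - c1 - c2"]) (auto simp: c1_def c2_def min_def)
qed

text \<open>Since \<open>(1 - c) / 2\<close> is the probability that a pair differs, the equation
  prescribes twice the sum of the three probabilities. The four cycle inequalities are those needed
  to insert the chords.\<close>

lemma correlations_exist:
  fixes v1 v2 v3 w1 w2 w3 e1 e2 e3 s :: real
  assumes e: "admissible v1 w2 e1" "admissible v2 w3 e2" "admissible v3 w1 e3"
    and s: "s = Max {- e1 + e2 + e3, e1 - e2 + e3, e1 + e2 - e3, - e1 - e2 - e3}"
  obtains c1 c2 c3 where "admissible w1 v1 c1" "admissible w2 v2 c2" "admissible w3 v3 c3"
    "3 - (c1 + c2 + c3) = max (\<bar>v1 - w1\<bar> + \<bar>v2 - w2\<bar> + \<bar>v3 - w3\<bar>) (s - 1)"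
    "\<bar>e1 + c2\<bar> + \<bar>e2 + c3\<bar> + \<bar>e3 - c1\<bar> \<le> 4"
    "\<bar>e3 + c1\<bar> + \<bar>e1 + c2\<bar> + \<bar>e2 - c3\<bar> \<le> 4"
    "\<bar>e2 + c3\<bar> + \<bar>e3 + c1\<bar> + \<bar>e1 - c2\<bar> \<le> 4"
    "\<bar>e1 - c2\<bar> + \<bar>e2 - c3\<bar> + \<bar>e3 - c1\<bar> \<le> 4"
proof -
  note lin = admissible_linear
  note E = lin[OF e(1)] lin[OF e(2)] lin[OF e(3)]
  have s_ge: "- e1 + e2 + e3 \<le> s" "e1 - e2 + e3 \<le> s" "e1 + e2 - e3 \<le> s" "- e1 - e2 - e3 \<le> s"
    unfolding s by simp_all
  have "s \<in> {- e1 + e2 + e3, e1 - e2 + e3, e1 + e2 - e3, - e1 - e2 - e3}"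
    unfolding s by (rule Max_in) simp_all
  then have s_cases: "s = - e1 + e2 + e3 \<or> s = e1 - e2 + e3 \<or> s = e1 + e2 - e3 \<or> s = - e1 - e2 - e3"
    by simp
  define d1 d2 d3 where d: "d1 = \<bar>v1 - w1\<bar>" "d2 = \<bar>v2 - w2\<bar>" "d3 = \<bar>v3 - w3\<bar>"
  have d_ge: "v1 - w1 \<le> d1" "w1 - v1 \<le> d1" "v2 - w2 \<le> d2" "w2 - v2 \<le> d2" "v3 - w3 \<le> d3" "w3 - v3 \<le> d3"
    unfolding d by linarith+
  have d_cases: "d1 = v1 - w1 \<or> d1 = w1 - v1" "d2 = v2 - w2 \<or> d2 = w2 - v2" "d3 = v3 - w3 \<or> d3 = w3 - v3"
    unfolding d by linarith+
  show thesis
  \<comment> \<open>Either every \<open>c\<close> takes its largest admissible value, or their sum is lowered to \<open>4 - s\<close>;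
    then only \<open>\<bar>c\<bar> \<le> 1\<close> matters for the cycle inequalities.\<close>
  proof (cases "s - 1 \<le> d1 + d2 + d3")
    case True
    have c: "admissible w1 v1 (1 - d1)" "admissible w2 v2 (1 - d2)" "admissible w3 v3 (1 - d3)"
      using E(7-10) E(17-20) E(27-30) unfolding d admissible_def by linarith+
    \<comment> \<open>These are the odd-sign cycle inequalities with \<open>1 - d\<close> for
      \<open>c\<close>. \<open>even\<close> and \<open>odd\<close> count minus signs among the
      \<open>e\<close>, and a numeral marks the \<open>c\<close> whose sign differs from the other
      two. The \<open>even1\<close> bounds telescope \<open>v1 - w1\<close> along the rest of the
      cycle.\<close>
    have even1: "e1 + e2 + e3 + d1 \<le> 3 + d2 + d3" "e1 - e2 - e3 + d1 \<le> 3 + d2 + d3"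
       "- e1 + e2 - e3 + d1 \<le> 3 + d2 + d3" "- e1 - e2 + e3 + d1 \<le> 3 + d2 + d3"
      using d_cases(1) by (elim disjE; use E d_ge in linarith)+
    have even2: "e1 + e2 + e3 + d2 \<le> 3 + d1 + d3" "e1 - e2 - e3 + d2 \<le> 3 + d1 + d3"
       "- e1 + e2 - e3 + d2 \<le> 3 + d1 + d3" "- e1 - e2 + e3 + d2 \<le> 3 + d1 + d3"
      using d_cases(2) by (elim disjE; use E d_ge in linarith)+
    have even3: "e1 + e2 + e3 + d3 \<le> 3 + d1 + d2" "e1 - e2 - e3 + d3 \<le> 3 + d1 + d2"
       "- e1 + e2 - e3 + d3 \<le> 3 + d1 + d2" "- e1 - e2 + e3 + d3 \<le> 3 + d1 + d2"
      using d_cases(3) by (elim disjE; use E d_ge in linarith)+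
    have even: "e1 + e2 + e3 + d1 + d2 + d3 \<le> 7" "e1 - e2 - e3 + d1 + d2 + d3 \<le> 7"
       "- e1 + e2 - e3 + d1 + d2 + d3 \<le> 7" "- e1 - e2 + e3 + d1 + d2 + d3 \<le> 7"
      using d_cases by (elim disjE; use E in linarith)+
    have odd1: "s + d2 + d3 \<le> 5 + d1"
      using d_cases(2,3) s_cases by (elim disjE; use E d_ge in linarith)
    have odd2: "s + d1 + d3 \<le> 5 + d2"
      using d_cases(1,3) s_cases by (elim disjE; use E d_ge in linarith)
    have odd3: "s + d1 + d2 \<le> 5 + d3"
      using d_cases(1,2) s_cases by (elim disjE; use E d_ge in linarith)
    note facts = even1 even2 even3 even odd1 odd2 odd3 s_ge True
    show thesis
    proof (rule that[OF c])
      show "3 - (1 - d1 + (1 - d2) + (1 - d3)) = max (\<bar>v1 - w1\<bar> + \<bar>v2 - w2\<bar> + \<bar>v3 - w3\<bar>) (s - 1)"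
        using True unfolding d[symmetric] by simp
    qed (use facts in linarith)+
  next
    case False
    have "s \<le> 3" using s_cases E by linarith
    \<comment> \<open>With every \<open>c\<close> at most 1 and \<open>c1 + c2 + c3 = 4 - s\<close>,
      a combination of the \<open>c\<close> with one or three minus signs is at most
      \<open>s\<close>, which leaves these bounds. They hold since an odd and an even sign pattern
      on three terms agree in at most two places.\<close>
    have even: "s + e1 + e2 + e3 \<le> 4" "s + e1 - e2 - e3 \<le> 4" "s - e1 + e2 - e3 \<le> 4" "s - e1 - e2 + e3 \<le> 4"
      using s_cases by (elim disjE; use E(5,6,15,16,25,26) in linarith)+
    \<comment> \<open>The target \<open>4 - s\<close> lies above the sum of the lower ends; that it
      lies below \<open>3 - d1 - d2 - d3\<close> is the case assumption.\<close>
    have low: "\<bar>w1 + v1\<bar> - 1 + (\<bar>w2 + v2\<bar> - 1) + (\<bar>w3 + v3\<bar> - 1) \<le> 4 - s"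
    proof -
      have "t1 + t2 + t3 \<le> 7 - s" if "t1 = w1 + v1 \<or> t1 = - w1 - v1" "t2 = w2 + v2 \<or> t2 = - w2 - v2"
          "t3 = w3 + v3 \<or> t3 = - w3 - v3" for t1 t2 t3
        using that s_cases by (elim disjE; use E in linarith)
      moreover have "\<bar>w + v\<bar> = w + v \<or> \<bar>w + v\<bar> = - w - v" for w v :: real by linarith
      ultimately have "\<bar>w1 + v1\<bar> + \<bar>w2 + v2\<bar> + \<bar>w3 + v3\<bar> \<le> 7 - s" by blast
      then show ?thesis by simp
    qed
    have ivl: "\<bar>w1 + v1\<bar> - 1 \<le> 1 - d1" "\<bar>w2 + v2\<bar> - 1 \<le> 1 - d2" "\<bar>w3 + v3\<bar> - 1 \<le> 1 - d3"
      using E(7-10) E(17-20) E(27-30) unfolding d by linarith+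
    obtain c1 c2 c3 where c: "\<bar>w1 + v1\<bar> - 1 \<le> c1" "c1 \<le> 1 - d1" "\<bar>w2 + v2\<bar> - 1 \<le> c2" "c2 \<le> 1 - d2"
      "\<bar>w3 + v3\<bar> - 1 \<le> c3" "c3 \<le> 1 - d3" "c1 + c2 + c3 = 4 - s"
      by (rule sum_of_interval_points[OF ivl low]) (use False in linarith)
    have adm: "admissible w1 v1 c1" "admissible w2 v2 c2" "admissible w3 v3 c3"
      using c(1-6) unfolding d admissible_def by (simp_all add: abs_minus_commute)
    have "c1 \<le> 1" "c2 \<le> 1" "c3 \<le> 1" using lin(5)[OF adm(1)] lin(5)[OF adm(2)] lin(5)[OF adm(3)] .
    note facts = this c(7) even \<open>s \<le> 3\<close> s_ge
    show thesis
    proof (rule that[OF adm])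
      show "3 - (c1 + c2 + c3) = max (\<bar>v1 - w1\<bar> + \<bar>v2 - w2\<bar> + \<bar>v3 - w3\<bar>) (s - 1)"
        using False c(7) unfolding d[symmetric] by simp
    qed (use facts in linarith)+
  qed
qed

section \<open>Laws of \<open>\<plusminus>1\<close> variables\<close>

definition has_moments :: "(real \<times> real) pmf \<Rightarrow> real \<Rightarrow> real \<Rightarrow> real \<Rightarrow> bool" where
  "has_moments p a b c \<longleftrightarrow> set_pmf p \<subseteq> pm1 \<times> pm1 \<and>
     measure_pmf.expectation p fst = a \<and> measure_pmf.expectation p snd = b \<and>
     measure_pmf.expectation p (\<lambda>(x, y). x * y) = c"

lemma expectation_pm1_pair:
  fixes f :: "real \<times> real \<Rightarrow> real"
  assumes "set_pmf p \<subseteq> pm1 \<times> pm1"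
  shows "measure_pmf.expectation p f = f (1, 1) * pmf p (1, 1) + f (1, -1) * pmf p (1, -1)
    + f (-1, 1) * pmf p (-1, 1) + f (-1, -1) * pmf p (-1, -1)"
proof -
  have "measure_pmf.expectation p f = (\<Sum>z\<in>{(1, 1), (1, -1), (-1, 1), (-1, -1)}. f z * pmf p z)"
    using assms by (intro integral_measure_pmf_real) (auto simp: pm1_def)
  then show ?thesis by simp
qed

lemma has_moments_pmf:
  assumes "has_moments p a b c"
  shows "pmf p (1, 1) = (1 + a + b + c) / 4" "pmf p (1, -1) = (1 + a - b - c) / 4"
    "pmf p (-1, 1) = (1 - a + b - c) / 4" "pmf p (-1, -1) = (1 - a - b + c) / 4"
proof -
  have supp: "set_pmf p \<subseteq> pm1 \<times> pm1" using assms by (simp add: has_moments_def)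
  \<comment> \<open>Total mass is the fourth linear equation for the four point masses.\<close>
  have "measure_pmf.expectation p (\<lambda>_. 1::real) = 1" by simp
  then show "pmf p (1, 1) = (1 + a + b + c) / 4" "pmf p (1, -1) = (1 + a - b - c) / 4"
    "pmf p (-1, 1) = (1 - a + b - c) / 4" "pmf p (-1, -1) = (1 - a - b + c) / 4"
    using assms unfolding has_moments_def expectation_pm1_pair[OF supp] by auto
qed

lemma has_moments_unique:
  assumes p: "has_moments p a b c" and q: "has_moments q a b c"
  shows "p = q"
proof (rule pmf_eqI)
  fix z
  show "pmf p z = pmf q z"
  proof (cases "z \<in> pm1 \<times> pm1")
    case True
    then show ?thesis using has_moments_pmf[OF p] has_moments_pmf[OF q] by (auto simp: pm1_def)
  next
    case False
    then have "z \<notin> set_pmf p" "z \<notin> set_pmf q" using p q by (auto simp: has_moments_def)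
    then show ?thesis by (simp add: set_pmf_iff)
  qed
qed

text \<open>The four inequalities are the nonnegativity of the four point masses.\<close>

lemma has_moments_admissible:
  assumes "has_moments p a b c"
  shows "admissible a b c"
  using pmf_nonneg[of p "(1, 1)"] pmf_nonneg[of p "(1, -1)"]
    pmf_nonneg[of p "(-1, 1)"] pmf_nonneg[of p "(-1, -1)"]
  unfolding has_moments_pmf[OF assms] admissible_def by (simp add: abs_le_iff)

lemma has_moments_prob_eq:
  assumes "has_moments p a b c"
  shows "measure_pmf.prob p {(x, y). x = y} = (1 + c) / 2"
proof -
  have supp: "set_pmf p \<subseteq> pm1 \<times> pm1" using assms by (simp add: has_moments_def)
  have "measure_pmf.prob p {(x, y). x = y} = measure_pmf.expectation p (indicator {(x, y). x = y})"
    by simp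
  also have "\<dots> = (1 + c) / 2"
    unfolding expectation_pm1_pair[OF supp] has_moments_pmf[OF assms] by (simp add: field_simps)
  finally show ?thesis .
qed

lemma has_moments_prob_neq:
  assumes "has_moments p a b c"
  shows "measure_pmf.prob p {(x, y). x \<noteq> y} = (1 - c) / 2"
proof -
  have "{(x, y). x \<noteq> y} = space (measure_pmf p) - {(x::real, y). x = y}" by auto
  then show ?thesis
    using measure_pmf.prob_compl[of "{(x::real, y). x = y}" p] has_moments_prob_eq[OF assms]
    by (simp add: field_simps)
qed

lemma has_moments_swap:
  assumes "has_moments (map_pmf (\<lambda>u. (f u, g u)) q) a b c"
  shows "has_moments (map_pmf (\<lambda>u. (g u, f u)) q) b a c"
  using assms by (auto simp: has_moments_def mult.commute image_subset_iff)

text \<open>A law on the eight sign patterns is fixed by three means, three correlations and the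
  moment of the triple product. Patterns with product 1 bound that moment from below, the others
  from above; the hypotheses say that these bounds are compatible.\<close>

lemma triangle_coupling:
  assumes "admissible a b x" "admissible b c y" "admissible c a z" "admissible x y z"
  obtains q where "has_moments (map_pmf (\<lambda>u. (fst u, fst (snd u))) q) a b x"
    "has_moments (map_pmf (\<lambda>u. (fst (snd u), snd (snd u))) q) b c y"
    "has_moments (map_pmf (\<lambda>u. (snd (snd u), fst u)) q) c a z"
proof -
  \<comment> \<open>\<open>m\<close> is the one free parameter, the expectation of the product of all three variables.\<close>
  define m where "m = Max {-(1+a+b+c+x+y+z), -(1+a-b-c-x+y-z), -(1-a+b-c-x-y+z), -(1-a-b+c+x-y-z)}"
  have m_ge: "-(1+a+b+c+x+y+z) \<le> m" "-(1+a-b-c-x+y-z) \<le> m" "-(1-a+b-c-x-y+z) \<le> m" "-(1-a-b+c+x-y-z) \<le> m"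
    unfolding m_def by simp_all
  note lin = admissible_linear(1-4)
  have "m \<in> {-(1+a+b+c+x+y+z), -(1+a-b-c-x+y-z), -(1-a+b-c-x-y+z), -(1-a-b+c+x-y-z)}"
    unfolding m_def by (rule Max_in) simp_all
  then have m_cases: "m = -(1+a+b+c+x+y+z) \<or> m = -(1+a-b-c-x+y-z) \<or> m = -(1-a+b-c-x-y+z) \<or> m = -(1-a-b+c+x-y-z)"
    by simp
  \<comment> \<open>Two patterns with opposite products differ in one place or in all three. The
    first case is an inequality for one of the pairs, the second one from
    \<open>admissible x y z\<close>.\<close>
  have m_le: "m \<le> 1-a+b+c-x+y-z" "m \<le> 1+a-b+c-x-y+z" "m \<le> 1+a+b-c+x-y-z" "m \<le> 1-a-b-c+x+y+z"
    using m_cases by (elim disjE;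
      (use lin[OF assms(1)] in linarith | use lin[OF assms(2)] in linarith |
       use lin[OF assms(3)] in linarith | use lin[OF assms(4)] in linarith))+
  \<comment> \<open>Fourier inversion on the cube: \<open>k1\<close> to \<open>k4\<close> are the
    masses of the patterns with product 1, \<open>k5\<close> to \<open>k8\<close> of those with
    product -1.\<close>
  define k1 k2 k3 k4 k5 k6 k7 k8 where k:
    "k1 = (1+a+b+c+x+y+z+m)/8" "k2 = (1+a-b-c-x+y-z+m)/8" "k3 = (1-a+b-c-x-y+z+m)/8" "k4 = (1-a-b+c+x-y-z+m)/8"
    "k5 = (1-a+b+c-x+y-z-m)/8" "k6 = (1+a-b+c-x-y+z-m)/8" "k7 = (1+a+b-c+x-y-z-m)/8" "k8 = (1-a-b-c+x+y+z-m)/8"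
  have k8: "8 * k1 = 1+a+b+c+x+y+z+m" "8 * k2 = 1+a-b-c-x+y-z+m" "8 * k3 = 1-a+b-c-x-y+z+m" "8 * k4 = 1-a-b+c+x-y-z+m"
    "8 * k5 = 1-a+b+c-x+y-z-m" "8 * k6 = 1+a-b+c-x-y+z-m" "8 * k7 = 1+a+b-c+x-y-z-m" "8 * k8 = 1-a-b-c+x+y+z-m"
    unfolding k by simp_all
  have pos: "0 \<le> (t + m) / 8" if "- t \<le> m" for t using that by simp
  have neg: "0 \<le> (t - m) / 8" if "m \<le> t" for t using that by simp
  have nonneg: "0 \<le> k1" "0 \<le> k2" "0 \<le> k3" "0 \<le> k4" "0 \<le> k5" "0 \<le> k6" "0 \<le> k7" "0 \<le> k8"
    unfolding k by (rule pos[OF m_ge(1)] pos[OF m_ge(2)] pos[OF m_ge(3)] pos[OF m_ge(4)]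
      neg[OF m_le(1)] neg[OF m_le(2)] neg[OF m_le(3)] neg[OF m_le(4)])+
  define xs where "xs = [((1::real,1::real,1::real), k1), ((1,-1,-1), k2), ((-1,1,-1), k3), ((-1,-1,1), k4),
    ((-1,1,1), k5), ((1,-1,1), k6), ((1,1,-1), k7), ((-1,-1,-1), k8)]"
  have wf: "pmf_of_list_wf xs"
  proof (rule pmf_of_list_wfI)
    show "r \<ge> 0" if "r \<in> set (map snd xs)" for r
      using that nonneg unfolding xs_def by auto
    have "k1 + (k2 + (k3 + (k4 + (k5 + (k6 + (k7 + k8)))))) = 1" using k8 by linarith
    then show "sum_list (map snd xs) = 1" by (simp add: xs_def)
  qed
  define q where "q = pmf_of_list xs"
  have supp: "set_pmf q \<subseteq> set (map fst xs)" unfolding q_def by (rule set_pmf_of_list[OF wf])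
  have E: "measure_pmf.expectation q f = (\<Sum>u\<leftarrow>xs. f (fst u) * snd u)" for f :: "_ \<Rightarrow> real"
  proof -
    have "measure_pmf.expectation q f = (\<Sum>u\<in>set (map fst xs). f u * pmf q u)"
      using supp by (intro integral_measure_pmf_real) auto
    then show ?thesis by (simp add: q_def pmf_pmf_of_list[OF wf]) (simp add: xs_def)
  qed
  have "set (map fst xs) \<subseteq> pm1 \<times> pm1 \<times> pm1" by (simp add: xs_def pm1_def)
  with supp have "set_pmf q \<subseteq> pm1 \<times> pm1 \<times> pm1" by blast
  then have s: "fst ` set_pmf q \<subseteq> pm1" "(fst \<circ> snd) ` set_pmf q \<subseteq> pm1" "(snd \<circ> snd) ` set_pmf q \<subseteq> pm1"
    by auto
  have moments: "measure_pmf.expectation q fst = a" "measure_pmf.expectation q (\<lambda>u. fst (snd u)) = b"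
    "measure_pmf.expectation q (\<lambda>u. snd (snd u)) = c" "measure_pmf.expectation q (\<lambda>u. fst u * fst (snd u)) = x"
    "measure_pmf.expectation q (\<lambda>u. fst (snd u) * snd (snd u)) = y"
    "measure_pmf.expectation q (\<lambda>u. snd (snd u) * fst u) = z"
    unfolding E xs_def list.map sum_list.Cons sum_list.Nil fst_conv snd_conv using k8 by linarith+
  show thesis
    by (rule that[of q]) (use s moments in \<open>simp_all add: has_moments_def image_subset_iff mem_Times_iff case_prod_unfold\<close>)
qed

text \<open>Gluing along a common image: equality of the images is \<open>rel_pmf (=)\<close>, and
  pulling this relation back along \<open>f\<close> and \<open>g\<close> yields a coupling supported
  where they agree.\<close>

lemma glue_pmf:
  assumes "map_pmf f p = map_pmf g q"
  obtains r where "map_pmf fst r = p" "map_pmf snd r = q" "\<And>z. z \<in> set_pmf r \<Longrightarrow> f (fst z) = g (snd z)"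
proof -
  have "rel_pmf (=) (map_pmf f p) (map_pmf g q)" using assms by (simp add: pmf.rel_eq)
  then have "rel_pmf (\<lambda>x y. f x = g y) p q" by (simp add: pmf.rel_map)
  then show thesis using that by (auto elim!: rel_pmf.cases)
qed

lemma s_odd_3: "s_odd [a, b, c] = Max {- a + b + c, a - b + c, a + b - c, - a - b - c}"
proof -
  have "{sum_list (map2 (*) s [a, b, c]) | s. length s = length [a, b, c] \<and> set s \<subseteq> {-1, 1} \<and>
      odd (length (filter (\<lambda>x. x = -1) s))} = {- a + b + c, a - b + c, a + b - c, - a - b - c}" (is "?L = ?R")
  proof
    show "?L \<subseteq> ?R" by (auto simp: length_Suc_conv numeral_3_eq_3)
    have "- a + b + c \<in> ?L" by (rule CollectI, rule exI[of _ "[-1, 1, 1]"]) simp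
    moreover have "a - b + c \<in> ?L" by (rule CollectI, rule exI[of _ "[1, -1, 1]"]) simp
    moreover have "a + b - c \<in> ?L" by (rule CollectI, rule exI[of _ "[1, 1, -1]"]) simp
    moreover have "- a - b - c \<in> ?L" by (rule CollectI, rule exI[of _ "[-1, -1, -1]"]) simp
    ultimately show "?R \<subseteq> ?L" by blast
  qed
  then show ?thesis unfolding s_odd_def by simp
qed

section \<open>Couplings of the system\<close>

type_synonym triple = "real \<times> real \<times> real"

lemma cyc_values: "cyc 1 = 2" "cyc 2 = 3" "cyc 3 = 1"
  by (simp_all add: cyc_def)

lemma system_coupling_exists:
  assumes P: "has_moments (P 1) v1 w2 e1" "has_moments (P 2) v2 w3 e2" "has_moments (P 3) v3 w1 e3"
    and c: "admissible w1 v1 c1" "admissible w2 v2 c2" "admissible w3 v3 c3"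
    and cyc: "\<bar>e1 + c2\<bar> + \<bar>e2 + c3\<bar> + \<bar>e3 - c1\<bar> \<le> 4"
      "\<bar>e3 + c1\<bar> + \<bar>e1 + c2\<bar> + \<bar>e2 - c3\<bar> \<le> 4"
      "\<bar>e2 + c3\<bar> + \<bar>e3 + c1\<bar> + \<bar>e1 - c2\<bar> \<le> 4"
      "\<bar>e1 - c2\<bar> + \<bar>e2 - c3\<bar> + \<bar>e3 - c1\<bar> \<le> 4"
  obtains S where "sys_coupling P S" "has_moments (map_pmf (\<lambda>(v, w). (v 1, w 1)) S) v1 w1 c1"
    "has_moments (map_pmf (\<lambda>(v, w). (v 2, w 2)) S) v2 w2 c2"
    "has_moments (map_pmf (\<lambda>(v, w). (v 3, w 3)) S) v3 w3 c3"
proof -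
  note e = P[THEN has_moments_admissible]
  obtain x y z where adm: "admissible e1 c2 x" "admissible e2 c3 y" "admissible e3 c1 z"
    "admissible v1 v2 x" "admissible v2 v3 y" "admissible v3 v1 z" "admissible x y z"
    by (rule chords_exist[OF e c cyc])
  \<comment> \<open>\<open>t\<close> is the law of (V1, V2, V3); \<open>q2\<close>,
    \<open>q3\<close>, \<open>q1\<close> are laws of (V1, W2, V2), (V2, W3, V3), (V3, W1, V1),
    numbered by their W.\<close>
  obtain t where t: "has_moments (map_pmf (\<lambda>u. (fst u, fst (snd u))) t) v1 v2 x"
    "has_moments (map_pmf (\<lambda>u. (fst (snd u), snd (snd u))) t) v2 v3 y"
    "has_moments (map_pmf (\<lambda>u. (snd (snd u), fst u)) t) v3 v1 z"
    by (rule triangle_coupling[OF adm(4-7)])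
  obtain q2 where q2: "has_moments (map_pmf (\<lambda>u. (fst u, fst (snd u))) q2) v1 w2 e1"
    "has_moments (map_pmf (\<lambda>u. (fst (snd u), snd (snd u))) q2) w2 v2 c2"
    "has_moments (map_pmf (\<lambda>u. (snd (snd u), fst u)) q2) v2 v1 x"
    by (rule triangle_coupling[OF e(1) c(2) _ adm(1)]) (use adm(4) admissible_commute in blast)
  obtain q3 where q3: "has_moments (map_pmf (\<lambda>u. (fst u, fst (snd u))) q3) v2 w3 e2"
    "has_moments (map_pmf (\<lambda>u. (fst (snd u), snd (snd u))) q3) w3 v3 c3"
    "has_moments (map_pmf (\<lambda>u. (snd (snd u), fst u)) q3) v3 v2 y"
    by (rule triangle_coupling[OF e(2) c(3) _ adm(2)]) (use adm(5) admissible_commute in blast)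
  obtain q1 where q1: "has_moments (map_pmf (\<lambda>u. (fst u, fst (snd u))) q1) v3 w1 e3"
    "has_moments (map_pmf (\<lambda>u. (fst (snd u), snd (snd u))) q1) w1 v1 c1"
    "has_moments (map_pmf (\<lambda>u. (snd (snd u), fst u)) q1) v1 v3 z"
    by (rule triangle_coupling[OF e(3) c(1) _ adm(3)]) (use adm(6) admissible_commute in blast)
  \<comment> \<open>Inner and outer triangles traverse their common chord in opposite directions,
    hence the swap before uniqueness identifies the two laws of the chord.\<close>
  obtain r1 where r1: "map_pmf fst r1 = t" "map_pmf snd r1 = q2"
    "\<And>\<omega>. \<omega> \<in> set_pmf r1 \<Longrightarrow> (fst (snd (fst \<omega>)), fst (fst \<omega>)) = (snd (snd (snd \<omega>)), fst (snd \<omega>))"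
    using glue_pmf[OF has_moments_unique[OF has_moments_swap[OF t(1)] q2(3)]] by blast
  have "map_pmf (\<lambda>\<omega>. (snd (snd (fst \<omega>)), fst (snd (fst \<omega>)))) r1 = map_pmf (\<lambda>u. (snd (snd u), fst u)) q3"
    using has_moments_unique[OF has_moments_swap[OF t(2)] q3(3)] by (simp add: r1(1)[symmetric] map_pmf_comp)
  from glue_pmf[OF this] obtain r2 where r2: "map_pmf fst r2 = r1" "map_pmf snd r2 = q3"
    "\<And>\<omega>. \<omega> \<in> set_pmf r2 \<Longrightarrow> (snd (snd (fst (fst \<omega>))), fst (snd (fst (fst \<omega>)))) = (snd (snd (snd \<omega>)), fst (snd \<omega>))"
    by blast
  have "map_pmf (\<lambda>\<omega>. (fst (fst (fst \<omega>)), snd (snd (fst (fst \<omega>))))) r2 = map_pmf (\<lambda>u. (snd (snd u), fst u)) q1"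
    using has_moments_unique[OF has_moments_swap[OF t(3)] q1(3)] by (simp add: r1(1)[symmetric] r2(1)[symmetric] map_pmf_comp)
  from glue_pmf[OF this] obtain r where r: "map_pmf fst r = r2" "map_pmf snd r = q1"
    "\<And>\<omega>. \<omega> \<in> set_pmf r \<Longrightarrow> (fst (fst (fst (fst \<omega>))), snd (snd (fst (fst (fst \<omega>))))) = (snd (snd (snd \<omega>)), fst (snd \<omega>))"
    by blast
  \<comment> \<open>Projections of the nested space of \<open>r\<close> to the inner triangle and
    the three outer ones.\<close>
  define T where "T = (\<lambda>\<omega> :: ((triple \<times> triple) \<times> triple) \<times> triple. fst (fst (fst \<omega>)))"
  define Q2 where "Q2 = (\<lambda>\<omega> :: ((triple \<times> triple) \<times> triple) \<times> triple. snd (fst (fst \<omega>)))"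
  define Q3 where "Q3 = (\<lambda>\<omega> :: ((triple \<times> triple) \<times> triple) \<times> triple. snd (fst \<omega>))"
  define Q1 where "Q1 = (\<lambda>\<omega> :: ((triple \<times> triple) \<times> triple) \<times> triple. snd \<omega>)"
  have q: "q2 = map_pmf Q2 r" "q3 = map_pmf Q3 r" "q1 = map_pmf Q1 r"
    by (simp_all add: Q2_def Q3_def Q1_def r(1,2)[symmetric] r2(1,2)[symmetric] r1(2)[symmetric] map_pmf_comp)
  have agree: "fst (T \<omega>) = fst (Q2 \<omega>)" "fst (snd (T \<omega>)) = snd (snd (Q2 \<omega>))"
    "fst (snd (T \<omega>)) = fst (Q3 \<omega>)" "snd (snd (T \<omega>)) = snd (snd (Q3 \<omega>))"
    "snd (snd (T \<omega>)) = fst (Q1 \<omega>)" "fst (T \<omega>) = snd (snd (Q1 \<omega>))" if "\<omega> \<in> set_pmf r" for \<omega>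
  proof -
    have 2: "fst \<omega> \<in> set_pmf r2" using that by (simp add: r(1)[symmetric])
    then have 1: "fst (fst \<omega>) \<in> set_pmf r1" by (simp add: r2(1)[symmetric])
    show "fst (T \<omega>) = fst (Q2 \<omega>)" "fst (snd (T \<omega>)) = snd (snd (Q2 \<omega>))"
      "fst (snd (T \<omega>)) = fst (Q3 \<omega>)" "snd (snd (T \<omega>)) = snd (snd (Q3 \<omega>))"
      "snd (snd (T \<omega>)) = fst (Q1 \<omega>)" "fst (T \<omega>) = snd (snd (Q1 \<omega>))"
      using r(3)[OF that] r2(3)[OF 2] r1(3)[OF 1] unfolding T_def Q1_def Q2_def Q3_def by (auto simp only: prod.inject)
  qed
  \<comment> \<open>Indices other than 1 and 2 share the value for 3; only the indices 1, 2, 3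
    matter to a coupling.\<close>
  define S where "S = map_pmf (\<lambda>\<omega>. (\<lambda>i::nat. if i = 1 then fst (T \<omega>) else if i = 2 then fst (snd (T \<omega>)) else snd (snd (T \<omega>)),
    \<lambda>i::nat. if i = 1 then fst (snd (Q1 \<omega>)) else if i = 2 then fst (snd (Q2 \<omega>)) else fst (snd (Q3 \<omega>)))) r"
  have VW: "map_pmf (\<lambda>(v, w). (v 1, w 2)) S = map_pmf (\<lambda>u. (fst u, fst (snd u))) q2"
    "map_pmf (\<lambda>(v, w). (v 2, w 3)) S = map_pmf (\<lambda>u. (fst u, fst (snd u))) q3"
    "map_pmf (\<lambda>(v, w). (v 3, w 1)) S = map_pmf (\<lambda>u. (fst u, fst (snd u))) q1"
    "map_pmf (\<lambda>(v, w). (v 1, w 1)) S = map_pmf (\<lambda>u. (snd (snd u), fst (snd u))) q1"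
    "map_pmf (\<lambda>(v, w). (v 2, w 2)) S = map_pmf (\<lambda>u. (snd (snd u), fst (snd u))) q2"
    "map_pmf (\<lambda>(v, w). (v 3, w 3)) S = map_pmf (\<lambda>u. (snd (snd u), fst (snd u))) q3"
    unfolding S_def q map_pmf_comp by (rule map_pmf_cong[OF refl], simp add: agree[symmetric])+
  show thesis
  proof (rule that)
    show "sys_coupling P S"
      unfolding sys_coupling_def
      by (intro ballI, elim insertE emptyE)
        (simp_all only: cyc_values VW has_moments_unique[OF q2(1) P(1)]
          has_moments_unique[OF q3(1) P(2)] has_moments_unique[OF q1(1) P(3)])
  qed (unfold VW, (rule has_moments_swap, rule q1 q2 q3)+)
qed

section \<open>Lower bound for all couplings of the system\<close>

lemma SZLG_has_moments:
  assumes "SZLG P"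
  shows "has_moments (P 1) (EV P 1) (EW P 2) (EVW P 1)" "has_moments (P 2) (EV P 2) (EW P 3) (EVW P 2)"
    "has_moments (P 3) (EV P 3) (EW P 1) (EVW P 3)"
  using assms by (simp_all add: SZLG_def has_moments_def EV_def EW_def EVW_def distV_def distW_def cpred_def)

lemma coupling_pm1_has_moments:
  assumes "set_pmf A \<subseteq> pm1" "set_pmf B \<subseteq> pm1" "coupling_of A B C"
  shows "has_moments C (measure_pmf.expectation A (\<lambda>x. x)) (measure_pmf.expectation B (\<lambda>x. x))
    (measure_pmf.expectation C (\<lambda>(x, y). x * y))"
proof -
  have AB: "A = map_pmf fst C" "B = map_pmf snd C" using assms(3) by (simp_all add: coupling_of_def)
  have "set_pmf C \<subseteq> pm1 \<times> pm1"
    using assms(1,2) unfolding AB by (auto simp: image_subset_iff)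
  then show ?thesis by (simp add: has_moments_def AB)
qed

lemma set_pmf_dist:
  assumes "SZLG P" "i \<in> {1, 2, 3}"
  shows "set_pmf (distV P i) \<subseteq> pm1" "set_pmf (distW P i) \<subseteq> pm1"
proof -
  have "cpred i \<in> {1, 2, 3}" using assms(2) by (auto simp: cpred_def)
  then have "set_pmf (P i) \<subseteq> pm1 \<times> pm1" "set_pmf (P (cpred i)) \<subseteq> pm1 \<times> pm1"
    using assms unfolding SZLG_def by blast+
  then show "set_pmf (distV P i) \<subseteq> pm1" "set_pmf (distW P i) \<subseteq> pm1"
    by (auto simp: distV_def distW_def)
qed

text \<open>The law of Wi is read off the pair with index \<open>cpred i\<close>, so two of the
  given pair laws enter.\<close>

lemma sys_coupling_coupling_of:
  assumes "sys_coupling P S" "i \<in> {1, 2, 3}"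
  shows "coupling_of (distV P i) (distW P i) (map_pmf (\<lambda>(v, w). (v i, w i)) S)"
proof -
  have i: "cpred i \<in> {1, 2, 3}" "cyc (cpred i) = i" using assms(2) by (auto simp: cpred_def cyc_def)
  have "P i = map_pmf (\<lambda>(v, w). (v i, w (cyc i))) S"
    "P (cpred i) = map_pmf (\<lambda>(v, w). (v (cpred i), w (cyc (cpred i)))) S"
    using assms i(1) unfolding sys_coupling_def by metis+
  then show ?thesis
    unfolding coupling_of_def distV_def distW_def i(2) by (simp add: map_pmf_comp case_prod_unfold)
qed

lemma prob_neq_map:
  "measure_pmf.prob S {(v, w). v i \<noteq> w i} = measure_pmf.prob (map_pmf (\<lambda>(v, w). (v i, w i)) S) {(x, y). x \<noteq> y}"
  by (simp add: vimage_def case_prod_unfold)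

lemma sys_coupling_has_moments:
  assumes "SZLG P" "sys_coupling P S" "i \<in> {1, 2, 3}"
  shows "has_moments (map_pmf (\<lambda>(v, w). (v i, w i)) S) (EV P i) (EW P i)
    (measure_pmf.expectation S (\<lambda>(v, w). v i * w i))"
  using coupling_pm1_has_moments[OF set_pmf_dist[OF assms(1,3)] sys_coupling_coupling_of[OF assms(2,3)]]
  by (simp add: EV_def EW_def case_prod_unfold)

text \<open>The six products along the cycle multiply to 1, as each variable occurs twice. With an
  odd number of minus signs the six signed products cannot all be 1, so their sum is at most 4;
  taking expectations gives the bound.\<close>

lemma s_odd_le_prob_neq:
  assumes P: "SZLG P" and S: "sys_coupling P S"
  shows "s_odd [EVW P 1, EVW P 2, EVW P 3] - 1 \<le> 2 * (\<Sum>i\<in>{1,2,3::nat}. measure_pmf.prob S {(v, w). v i \<noteq> w i})"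
proof -
  have supp: "v i \<in> {1, -1}" "w i \<in> {1, -1}" if "(v, w) \<in> set_pmf S" "i \<in> {1, 2, 3}" for v w i
    using sys_coupling_has_moments[OF P S that(2)] that(1) by (auto simp: has_moments_def pm1_def)
  \<comment> \<open>The values outside 1, 2, 3 are arbitrary, so \<open>S\<close> may have infinite
    support; integrability comes from boundedness.\<close>
  have int: "integrable S (\<lambda>(v, w). v i * w j)" if "i \<in> {1, 2, 3}" "j \<in> {1, 2, 3}" for i j
  proof (rule measure_pmf.integrable_const_bound[where B = 1])
    show "AE u in S. norm (case u of (v, w) \<Rightarrow> v i * w j) \<le> 1"
      unfolding AE_measure_pmf_iff
    proof clarify
      fix v w assume "(v, w) \<in> set_pmf S"
      from supp(1)[OF this that(1)] supp(2)[OF this that(2)] show "norm (v i * w j) \<le> 1" by auto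
    qed
  qed simp
  have "EVW P i = measure_pmf.expectation S (\<lambda>(v, w). v i * w (cyc i))" if "i \<in> {1, 2, 3}" for i
  proof -
    have *: "map_pmf (\<lambda>(v, w). (v i, w (cyc i))) S = P i" using S that unfolding sys_coupling_def by blast
    show ?thesis unfolding EVW_def *[symmetric] by (simp add: case_prod_unfold)
  qed
  from this[of 1] this[of 2] this[of 3]
  have EVW: "EVW P 1 = measure_pmf.expectation S (\<lambda>(v, w). v 1 * w 2)"
    "EVW P 2 = measure_pmf.expectation S (\<lambda>(v, w). v 2 * w 3)"
    "EVW P 3 = measure_pmf.expectation S (\<lambda>(v, w). v 3 * w 1)"
    unfolding cyc_values by simp_all
  have prob: "2 * measure_pmf.prob S {(v, w). v i \<noteq> w i} = 1 - measure_pmf.expectation S (\<lambda>(v, w). v i * w i)"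
    if "i \<in> {1, 2, 3}" for i
    unfolding prob_neq_map has_moments_prob_neq[OF sys_coupling_has_moments[OF P S that]] by simp
  have key: "s1 * EVW P 1 + s2 * EVW P 2 + s3 * EVW P 3 - 1
      \<le> 2 * (\<Sum>i\<in>{1,2,3::nat}. measure_pmf.prob S {(v, w). v i \<noteq> w i})"
    if s: "(s1, s2, s3) \<in> {(-1, 1, 1), (1, -1, 1), (1, 1, -1), (-1, -1, -1)}" for s1 s2 s3
  proof -
    have "measure_pmf.expectation S (\<lambda>u. s1 * (case u of (v, w) \<Rightarrow> v 1 * w 2) + s2 * (case u of (v, w) \<Rightarrow> v 2 * w 3)
        + s3 * (case u of (v, w) \<Rightarrow> v 3 * w 1) + (case u of (v, w) \<Rightarrow> v 1 * w 1) + (case u of (v, w) \<Rightarrow> v 2 * w 2)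
        + (case u of (v, w) \<Rightarrow> v 3 * w 3)) \<le> measure_pmf.expectation S (\<lambda>_. 4)"
    proof (rule integral_mono_AE)
      show "AE u in S. s1 * (case u of (v, w) \<Rightarrow> v 1 * w 2) + s2 * (case u of (v, w) \<Rightarrow> v 2 * w 3)
        + s3 * (case u of (v, w) \<Rightarrow> v 3 * w 1) + (case u of (v, w) \<Rightarrow> v 1 * w 1) + (case u of (v, w) \<Rightarrow> v 2 * w 2)
        + (case u of (v, w) \<Rightarrow> v 3 * w 3) \<le> 4"
        unfolding AE_measure_pmf_iff
      proof (intro ballI, clarify)
        fix v w assume "(v, w) \<in> set_pmf S"
        then have "v 1 \<in> {1, -1}" "v 2 \<in> {1, -1}" "v 3 \<in> {1, -1}" "w 1 \<in> {1, -1}" "w 2 \<in> {1, -1}" "w 3 \<in> {1, -1}"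
          by (simp_all only: supp insertI1 insertI2)
        then show "s1 * (v 1 * w 2) + s2 * (v 2 * w 3) + s3 * (v 3 * w 1) + v 1 * w 1 + v 2 * w 2 + v 3 * w 3 \<le> 4"
          using s by auto
      qed
    qed (use int in auto)
    then have "s1 * EVW P 1 + s2 * EVW P 2 + s3 * EVW P 3 + measure_pmf.expectation S (\<lambda>(v, w). v 1 * w 1)
      + measure_pmf.expectation S (\<lambda>(v, w). v 2 * w 2) + measure_pmf.expectation S (\<lambda>(v, w). v 3 * w 3) \<le> 4"
      unfolding EVW using int by simp
    then show ?thesis using prob[of 1] prob[of 2] prob[of 3] by simp
  qed
  have "s_odd [EVW P 1, EVW P 2, EVW P 3] \<in> {- EVW P 1 + EVW P 2 + EVW P 3, EVW P 1 - EVW P 2 + EVW P 3,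
      EVW P 1 + EVW P 2 - EVW P 3, - EVW P 1 - EVW P 2 - EVW P 3}"
    unfolding s_odd_3 by (rule Max_in) simp_all
  then show ?thesis
    using key[of "-1" 1 1] key[of 1 "-1" 1] key[of 1 1 "-1"] key[of "-1" "-1" "-1"]
    by (elim insertE) simp_all
qed

section \<open>Maximal couplings of two \<open>\<plusminus>1\<close> variables\<close>

lemma pm1_pmf_unique:
  assumes "set_pmf p \<subseteq> pm1" "set_pmf q \<subseteq> pm1"
    and "measure_pmf.expectation p (\<lambda>x. x) = measure_pmf.expectation q (\<lambda>x. x)"
  shows "p = q"
proof -
  have E: "measure_pmf.expectation r f = f 1 * pmf r 1 + f (-1) * pmf r (-1)"
    if "set_pmf r \<subseteq> pm1" for r and f :: "real \<Rightarrow> real"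
  proof -
    have "measure_pmf.expectation r f = (\<Sum>z\<in>{1, -1}. f z * pmf r z)"
      using that by (intro integral_measure_pmf_real) (auto simp: pm1_def)
    then show ?thesis by simp
  qed
  have r: "pmf r 1 = (1 + measure_pmf.expectation r (\<lambda>x. x)) / 2"
    "pmf r (-1) = (1 - measure_pmf.expectation r (\<lambda>x. x)) / 2" if "set_pmf r \<subseteq> pm1" for r
    using E[OF that, of "\<lambda>x. x"] E[OF that, of "\<lambda>_. 1"] by simp_all
  show ?thesis
  proof (rule pmf_eqI)
    fix z
    show "pmf p z = pmf q z"
    proof (cases "z \<in> pm1")
      case True
      then show ?thesis using r[OF assms(1)] r[OF assms(2)] assms(3) by (auto simp: pm1_def)
    next
      case False
      then have "z \<notin> set_pmf p" "z \<notin> set_pmf q" using assms(1,2) by auto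
      then show ?thesis by (simp add: set_pmf_iff)
    qed
  qed
qed

text \<open>With fixed means, the mass of the diagonal grows with the correlation, whose upper limit
  \<open>1 - |a - b|\<close> is attained by some coupling.\<close>

lemma maximal_coupling_pm1_iff:
  assumes A: "set_pmf A \<subseteq> pm1" and B: "set_pmf B \<subseteq> pm1" and C: "coupling_of A B C"
  shows "maximal_coupling A B C \<longleftrightarrow> measure_pmf.prob C {(x, y). x \<noteq> y}
    = \<bar>measure_pmf.expectation A (\<lambda>x. x) - measure_pmf.expectation B (\<lambda>x. x)\<bar> / 2"
proof -
  define a b where "a = measure_pmf.expectation A (\<lambda>x. x)" and "b = measure_pmf.expectation B (\<lambda>x. x)"
  have mom: "has_moments C' a b (measure_pmf.expectation C' (\<lambda>(x, y). x * y))" if "coupling_of A B C'" for C'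
    using coupling_pm1_has_moments[OF A B that] by (simp add: a_def b_def)
  have le: "measure_pmf.expectation C' (\<lambda>(x, y). x * y) \<le> 1 - \<bar>a - b\<bar>" if "coupling_of A B C'" for C'
    using has_moments_admissible[OF mom[OF that]] by (simp add: admissible_def)
  note ab = admissible_bounds[OF has_moments_admissible[OF mom[OF C]]]
  \<comment> \<open>The pair law comes from a triangle with an auxiliary third variable of mean 0,
    uncorrelated with the other two.\<close>
  have adm: "admissible a b (1 - \<bar>a - b\<bar>)" "admissible b 0 0" "admissible 0 a 0" "admissible (1 - \<bar>a - b\<bar>) 0 0"
    using ab(1,2) unfolding admissible_def by linarith+
  obtain D where D: "has_moments D a b (1 - \<bar>a - b\<bar>)"
    using triangle_coupling[OF adm] by blast
  have supp: "set_pmf D \<subseteq> pm1 \<times> pm1" using D by (simp add: has_moments_def)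
  have "map_pmf fst D = A"
    by (rule pm1_pmf_unique[OF _ A]) (use supp D in \<open>auto simp: has_moments_def a_def\<close>)
  moreover have "map_pmf snd D = B"
    by (rule pm1_pmf_unique[OF _ B]) (use supp D in \<open>auto simp: has_moments_def b_def\<close>)
  ultimately have "coupling_of A B D" by (simp add: coupling_of_def)
  have "maximal_coupling A B C \<longleftrightarrow> 1 - \<bar>a - b\<bar> \<le> measure_pmf.expectation C (\<lambda>(x, y). x * y)" (is "?L \<longleftrightarrow> ?R")
  proof
    assume ?L
    with \<open>coupling_of A B D\<close> show ?R
      unfolding maximal_coupling_def
      using has_moments_prob_eq[OF mom[OF C]] has_moments_prob_eq[OF D] by force
  next
    assume ?R
    have "measure_pmf.prob C' {(x, y). x = y} \<le> measure_pmf.prob C {(x, y). x = y}"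
      if "coupling_of A B C'" for C'
      unfolding has_moments_prob_eq[OF mom[OF that]] has_moments_prob_eq[OF mom[OF C]]
      using le[OF that] \<open>?R\<close> by simp
    with C show ?L by (simp add: maximal_coupling_def)
  qed
  also have "\<dots> \<longleftrightarrow> measure_pmf.prob C {(x, y). x \<noteq> y} = \<bar>a - b\<bar> / 2"
    unfolding has_moments_prob_neq[OF mom[OF C]] using le[OF C] by auto
  finally show ?thesis unfolding a_def b_def .
qed

section \<open>Minimal total mismatch and the criterion for noncontextuality\<close>

theorem theorem37:
  fixes P :: "nat \<Rightarrow> (real \<times> real) pmf"
  assumes "SZLG P"
  shows "Delta0 P = (1/2) * (\<Sum>i\<in>{1,2,3::nat}. \<bar>EV P i - EW P i\<bar>)
    \<and> Deltamin P = (1/2) * max (2 * Delta0 P) (s_odd [EVW P 1, EVW P 2, EVW P 3] - 1)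
    \<and> CNTX P = (1/2) * max 0 (s_odd [EVW P 1, EVW P 2, EVW P 3] - 1
                                 - (\<Sum>i\<in>{1,2,3::nat}. \<bar>EV P i - EW P i\<bar>))
    \<and> (noncontextual P \<longleftrightarrow>
           s_odd [EVW P 1, EVW P 2, EVW P 3] \<le> 1 + (\<Sum>i\<in>{1,2,3::nat}. \<bar>EV P i - EW P i\<bar>))"
proof -
  define neq where "neq S i = measure_pmf.prob S {(v, w). v i \<noteq> w i}"
    for S :: "((nat \<Rightarrow> real) \<times> (nat \<Rightarrow> real)) pmf" and i :: nat
  define d where "d i = \<bar>EV P i - EW P i\<bar>" for i
  define s where "s = s_odd [EVW P 1, EVW P 2, EVW P 3]"
  define M where "M = max (d 1 + d 2 + d 3) (s - 1)"
  have sum3: "(\<Sum>i\<in>{1,2,3::nat}. f i) = f 1 + f 2 + f 3" for f :: "nat \<Rightarrow> real" by simp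
  have neq_ge: "d i / 2 \<le> neq S i" if "sys_coupling P S" "i \<in> {1, 2, 3}" for S i
  proof -
    note mom = sys_coupling_has_moments[OF assms that]
    show ?thesis
      using has_moments_admissible[OF mom] unfolding neq_def d_def prob_neq_map has_moments_prob_neq[OF mom]
      by (simp add: admissible_def)
  qed
  have maximal_iff: "maximal_coupling (distV P i) (distW P i) (map_pmf (\<lambda>(v, w). (v i, w i)) S) \<longleftrightarrow> neq S i = d i / 2"
    if "sys_coupling P S" "i \<in> {1, 2, 3}" for S i
    using maximal_coupling_pm1_iff[OF set_pmf_dist[OF assms that(2)] sys_coupling_coupling_of[OF that]]
    unfolding neq_def d_def prob_neq_map EV_def EW_def .
  have lower: "M / 2 \<le> neq S 1 + neq S 2 + neq S 3" if "sys_coupling P S" for S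
    using s_odd_le_prob_neq[OF assms that] neq_ge[OF that, of 1] neq_ge[OF that, of 2] neq_ge[OF that, of 3]
    unfolding M_def neq_def[symmetric] s_def[symmetric] sum3 by simp
  note P = SZLG_has_moments[OF assms]
  obtain c1 c2 c3 where c: "admissible (EW P 1) (EV P 1) c1" "admissible (EW P 2) (EV P 2) c2" "admissible (EW P 3) (EV P 3) c3"
    and cM: "3 - (c1 + c2 + c3) = M"
    and cyc: "\<bar>EVW P 1 + c2\<bar> + \<bar>EVW P 2 + c3\<bar> + \<bar>EVW P 3 - c1\<bar> \<le> 4"
      "\<bar>EVW P 3 + c1\<bar> + \<bar>EVW P 1 + c2\<bar> + \<bar>EVW P 2 - c3\<bar> \<le> 4"
      "\<bar>EVW P 2 + c3\<bar> + \<bar>EVW P 3 + c1\<bar> + \<bar>EVW P 1 - c2\<bar> \<le> 4"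
      "\<bar>EVW P 1 - c2\<bar> + \<bar>EVW P 2 - c3\<bar> + \<bar>EVW P 3 - c1\<bar> \<le> 4"
    unfolding M_def d_def
    by (rule correlations_exist[OF P[THEN has_moments_admissible] s_def[unfolded s_odd_3]])
  \<comment> \<open>This coupling serves twice: it attains the infimum, and it is the witness for
    noncontextuality when the criterion holds.\<close>
  obtain S where S: "sys_coupling P S" and
    "has_moments (map_pmf (\<lambda>(v, w). (v 1, w 1)) S) (EV P 1) (EW P 1) c1"
    "has_moments (map_pmf (\<lambda>(v, w). (v 2, w 2)) S) (EV P 2) (EW P 2) c2"
    "has_moments (map_pmf (\<lambda>(v, w). (v 3, w 3)) S) (EV P 3) (EW P 3) c3"
    by (rule system_coupling_exists[OF P c cyc])
  from this(2-4)[THEN has_moments_prob_neq]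
  have attained: "neq S 1 + neq S 2 + neq S 3 = M / 2"
    unfolding neq_def prob_neq_map cM[symmetric] by (simp add: field_simps)
  have Deltamin: "Deltamin P = M / 2"
    unfolding Deltamin_def neq_def[symmetric] sum3
    by (rule cInf_eq_minimum) (use S attained lower in \<open>auto intro: exI[of _ S]\<close>)
  have Delta0: "2 * Delta0 P = d 1 + d 2 + d 3"
    unfolding Delta0_def sum3 d_def by simp
  have "noncontextual P \<longleftrightarrow> s - 1 \<le> d 1 + d 2 + d 3"
  proof
    assume "noncontextual P"
    then obtain S' where S': "sys_coupling P S'"
      and "\<And>i. i \<in> {1, 2, 3} \<Longrightarrow> maximal_coupling (distV P i) (distW P i) (map_pmf (\<lambda>(v, w). (v i, w i)) S')"
      unfolding noncontextual_def by blast
    then have "neq S' i = d i / 2" if "i \<in> {1, 2, 3}" for i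
      using maximal_iff that by blast
    from this[of 1] this[of 2] this[of 3] lower[OF S'] show "s - 1 \<le> d 1 + d 2 + d 3"
      by (simp add: M_def)
  next
    assume "s - 1 \<le> d 1 + d 2 + d 3"
    then have "neq S 1 + neq S 2 + neq S 3 = d 1 / 2 + d 2 / 2 + d 3 / 2"
      using attained by (simp add: M_def)
    \<comment> \<open>Each term is at least its bound, so equality of the sums forces equality term
      by term.\<close>
    then have "neq S 1 = d 1 / 2" "neq S 2 = d 2 / 2" "neq S 3 = d 3 / 2"
      using neq_ge[OF S, of 1] neq_ge[OF S, of 2] neq_ge[OF S, of 3] by simp_all
    then have "neq S i = d i / 2" if "i \<in> {1, 2, 3}" for i
      using that by auto
    then show "noncontextual P"
      unfolding noncontextual_def using S maximal_iff[OF S] by blast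
  qed
  moreover have "CNTX P = (1/2) * max 0 (s - 1 - (d 1 + d 2 + d 3))"
    using Delta0 unfolding CNTX_def Deltamin M_def by (simp add: max_def)
  ultimately show ?thesis
    using Deltamin Delta0 unfolding s_def[symmetric] d_def[symmetric] sum3 M_def by auto
qed

end
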